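(* (Grounded Methods Never Dispatch.) Let $M$ be an initial well-formed method table (i.e. a well-formed table consisting of original methods only). Suppose that, in the operational semantics with the optimizing compiler $\mathit{jit}$, $$(\epsilon\ \mathsf{main}()),\,M\ \rightarrow^*\ (E\ \,s\,\bar s)\cdot F,\,M'$$ where $s$ is a direct call $\%i\leftarrow \%j\,?\,m!\bar T(\overline{\%k}):\%l$, and suppose that $m!\bar T$ is a type-grounded method instance in $M'$. Then $m!\bar T$ is fully devirtualized in $M'$, i.e. the body of $m!\bar T$ in $M'$ contains no dispatched calls.
   Context: **Types, sequences.** Types $\tau$ are concrete ($T$) or abstract ($A$). They come from a fixed finite type table whose entries $T!\bar\tau<:A$ declare a concrete type $T$ with field types $\bar\tau$ and a supertype $A$; predefined are the concrete type $\mathsf{Int}$ and the abstract type $\mathsf{Any}$, a supertype of all types. Subtyping $<:$ is a partial order; the only subtype of a concrete type is itself. $\bar x$ is a finite sequence (indexed from 0), $\epsilon$ the empty sequence, juxtaposition is concatenation, $\bar x[\bar k]$ is the sequence of elements of $\bar x$ at indices $\bar k$; $\bar\tau<:\bar\tau'$ is pointwise (equal lengths). $\bar T$ always denotes a sequence of concrete types, so "$\bar\tau[\bar k]=\bar T$" says in particular that these types are all concrete. **Instructions** $s$, each assigning a register $\%i$: $\%i\leftarrow p$ ($p\in\mathbb Z$); $\%i\leftarrow\%j$; $\%i\leftarrow T(\overline{\%k})$ (allocation); $\%i\leftarrow\%j[k]$ (field access); dispatched call $\%i\leftarrow\%j\,?\,m(\overline{\%k}):\%l$; direct call $\%i\leftarrow\%j\,?\,m!\bar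 T(\overline{\%k}):\%l$. **Method tables.** A method table $M$ is a finite set of entries $\langle m!\bar\tau'\,\bar s,\ \bar\tau\rangle$: a method named $m$ with parameter types (signature) $\bar\tau'$, body $\bar s$, and original signature $\bar\tau$. If $\bar\tau'=\bar\tau$ the entry is an original method (its body has no direct calls); otherwise it is a method instance (specialization) of the original method $m!\bar\tau$. An instance with empty body is a stub. $m!\bar\tau'\in M$ means $M$ has an entry with that name and signature, $M[m!\bar\tau']$ is that entry. $\lfloor M\rfloor$ is the table of original methods of $M$. **Dispatch.** $\mathcal D(M,m,\bar T)$ is the method $m!\bar\tau\in M$ with (1) $\bar T<:\bar\tau$ and (2) for all $m!\bar\tau'\in M$, $\bar T<:\bar\tau'$ implies $\bar\tau<:\bar\tau'$; it is undefined if no such method exists. **Type inference** $\mathcal I$ is a fixed partial function: $\mathcal I(M,\bar\tau,\bar s)=\bar\tau'$ gives one type per instruction of $\bar s$ (type of its register), for parameter types $\bar\tau$. It satisfies Monotonicity: if $\mathcal I(M,\bar\tau,\bar s)=\bar\tau'$ and $\bar\tau''<:\bar\tau$ then $\mathcal I(M,\bar\tau'',\bar s)$ is defined and $<:\bar\tau'$; and Soundness (below). **Well-formedness** $\mathit{WF}(M)$: (1) $\mathsf{main}!\epsilon\in M$; (2) every type in $M$ other than $\mathsf{Int},\mathsf{Any}$ is declared in the type table; (3) in each method registers are numbered consecutively from 0, first parameters then instructions, and an instruction assigning $\%k$ refers only to registers $\%i$ with $i<k$; (4) each original method $m!\bar\tau$ has a non-empty body $\bar s$ without direct calls, and $\mathcal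 I(\lfloor M\rfloor,\bar\tau,\bar s)$ is defined; (5) distinct entries with the same name have distinct signatures; (6) for each instance with signature $\bar\tau'$ and original signature $\bar\tau\ne\bar\tau'$: $\bar\tau'=\bar T$ is concrete, $\bar T<:\bar\tau$, the original method $m!\bar\tau$ is in $M$, and for every original method $m!\bar\tau''\in M$, $\bar T<:\bar\tau''$ implies $\bar\tau<:\bar\tau''$. **Compilation.** The relation $\bar\tau\vdash s,M\leadsto s',M'$ (register typing $\bar\tau$, instruction $s$ that is not a direct call) and the partial function $\mathit{jit}$ are defined by mutual induction. (a) If $s$ is not a call: $\bar\tau\vdash s,M\leadsto s,M$. (b) If $s=\%i\leftarrow\%j\,?\,m(\overline{\%k}):\%l$ and $\bar\tau[\bar k]$ are not all concrete: $\bar\tau\vdash s,M\leadsto s,M$. (c) If $s$ is as in (b) but $\bar\tau[\bar k]=\bar T$ and $\mathit{jit}(M,m,\bar T)=M'$: $\bar\tau\vdash s,M\leadsto (\%i\leftarrow\%j\,?\,m!\bar T(\overline{\%k}):\%l),M'$. (d) If $m!\bar T\in M$ then $\mathit{jit}(M,m,\bar T)=M$. (e) If $m!\bar T\notin M$, $\mathcal D(M,m,\bar T)$ is $m!\bar\tau'$ with body $s_0\dots s_n$, $\mathcal I(\lfloor M\rfloor,\bar T,s_0\dots s_n)=\bar\tau''$, $M_0=M+\langle m!\bar T\,\epsilon,\bar\tau'\rangle$ (add a stub), and $\bar T\,\bar\tau''\vdash s_r,M_r\leadsto s'_r,M_{r+1}$ for $r=0,\dots,n$, then $\mathit{jit}(M,m,\bar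 T)$ is $M_{n+1}$ with the stub $m!\bar T$ replaced by $\langle m!\bar T\,s'_0\dots s'_n,\bar\tau'\rangle$. **Semantics.** Values $v::=p\mid T(\bar v)$, $\mathrm{typeof}(p)=\mathsf{Int}$, $\mathrm{typeof}(T(\bar v))=T$. An environment $E$ is a sequence of values (contents of registers $\%0,\%1,\dots$); $E+v$ appends. A stack is $F::=\epsilon\mid(E\ \bar s)\cdot F$; a configuration is $F,M$. Steps of $(E\ s\,\bar s)\cdot F,M$: if $s$ is $\%i\leftarrow p$, $\%i\leftarrow\%j$, $\%i\leftarrow T(\overline{\%k})$ or $\%i\leftarrow\%j[k]$, step to $(E+v\ \bar s)\cdot F,M$ with $v=p$, $E[j]$, $T(E[\bar k])$, or the $k$-th field of $E[j]$, respectively; if $s$ is a (dispatched or direct) call with guard $E[j]=0$, step to $(E+E[l]\ \bar s)\cdot F,M$; if $s$ is a dispatched call and $E[j]\neq0$, let $\bar T=\mathrm{typeof}(E[\bar k])$, $M'=\mathit{jit}(M,m,\bar T)$, and step to $(E[\bar k]\ \bar s')\cdot(E\ s\,\bar s)\cdot F,M'$ with $\bar s'$ the body of $\mathcal D(M',m,\bar T)$; if $s$ is a direct call and $E[j]\ne0$, step to $(E[\bar k]\ \bar s')\cdot(E\ s\,\bar s)\cdot F,M$ with $\bar s'$ the body of $M[m!\bar T]$. Return: $(E'\ \epsilon)\cdot(E\ s\,\bar s)\cdot F,M\rightarrow(E+\mathrm{last}(E')\ \bar s)\cdot F,M$. There is no step when a needed item is undefined. The semantics is parameterized by $\mathit{jit}$,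 which is either the compiler above or the identity $\mathit{jit}(M,m,\bar T)=M$. The initial frame $\epsilon\ \mathsf{main}()$ has the empty environment and an unconditional call, i.e. a conditional dispatched call with non-zero guard, e.g. $\%0\leftarrow1$; $\%1\leftarrow\%0\,?\,\mathsf{main}():\%0$. A non-empty configuration that cannot step has *erred* if its top frame starts with a dispatched call to some $m$ having an entry in $M$ and $\mathcal D(M,m,\bar T)$ is undefined for the types $\bar T$ of the argument values. Soundness of $\mathcal I$ (for $\rightarrow$ under either choice of $\mathit{jit}$): if $\mathcal I(M,\bar\tau,\bar s)=\bar\tau'$, then for every $E$ with $\mathrm{typeof}(E)<:\bar\tau$ and every $F$: (1) if $(E\ \bar s)\cdot F,M\rightarrow^*F'\cdot F,M'$, where $F'$ is non-empty and not a single frame with no instructions, and the latter cannot step, then it has erred; (2) if $(E\ \bar s)\cdot F,M\rightarrow^*(E\,E'\ \bar s'')\cdot F,M'$, then $\bar s=\bar s'\,\bar s''$ for some $\bar s'$ and $\mathrm{typeof}(E'_i)<:\tau'_i$ for all $i$. **Groundedness.** An original method $m!\bar\tau$ with body $\bar s$ in a well-formed $M$ is type-grounded for concrete $\bar T<:\bar\tau$ if $\mathcal I(\lfloor M\rfloor,\bar T,\bar s)$ consists of concrete types only. A method instance $\langle m!\bar T\,\bar s',\bar\tau\rangle$ is type-grounded if its original method $m!\bar\tau$ is type-grounded for $\bar T$. A method instance is fully devirtualized if its body contains no dispatched calls. *)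

theory Defs
  imports Main "HOL-Library.FSet" "HOL-Library.Finite_Map"
begin

section \<open>Types, instructions and method tables\<close>

text \<open>
  The predefined types are not entries of the type table, so they get constructors of their own;
  all other type names are arbitrary strings.
\<close>

datatype cty = IntT | CName string
datatype aty = AnyT | AName string
datatype ty = Conc cty | Abs aty

text \<open>The entry for a concrete type name: its field types and its abstract supertype.\<close>

type_synonym type_table = "(string, ty list \<times> aty) fmap"

text \<open>An abstract type is declared by occurring as the supertype of an entry.\<close>

definition declared :: "type_table \<Rightarrow> ty set" where
  "declared D =
     {Conc (CName n) | n. n |\<in>| fmdom D} \<union>
     {Abs a | a. \<exists>n fs. fmlookup D n = Some (fs, a)}"

type_synonym mname = string

datatype instr =
    Const nat int
  | Move nat nat
  | Alloc nat cty "nat list"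
  | Field nat nat nat
  | DispCall nat nat mname "nat list" nat
  | DirCall nat nat mname "cty list" "nat list" nat
  \<comment> \<open>\<open>DispCall i j m ks l\<close> is \<open>%i \<leftarrow> %j ? m(%ks) : %l\<close>,
      and \<open>DirCall i j m Ts ks l\<close> is \<open>%i \<leftarrow> %j ? m!Ts(%ks) : %l\<close>\<close>

fun is_disp :: "instr \<Rightarrow> bool" where
  "is_disp (DispCall i j m ks l) = True"
| "is_disp _ = False"

fun is_dir :: "instr \<Rightarrow> bool" where
  "is_dir (DirCall i j m Ts ks l) = True"
| "is_dir _ = False"

fun target :: "instr \<Rightarrow> nat" where
  "target (Const i p) = i"
| "target (Move i j) = i"
| "target (Alloc i T ks) = i"
| "target (Field i j k) = i"
| "target (DispCall i j m ks l) = i"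
| "target (DirCall i j m Ts ks l) = i"

fun refs :: "instr \<Rightarrow> nat set" where
  "refs (Const i p) = {}"
| "refs (Move i j) = {j}"
| "refs (Alloc i T ks) = set ks"
| "refs (Field i j k) = {j}"
| "refs (DispCall i j m ks l) = {j, l} \<union> set ks"
| "refs (DirCall i j m Ts ks l) = {j, l} \<union> set ks"

fun instr_types :: "instr \<Rightarrow> ty set" where
  "instr_types (Alloc i T ks) = {Conc T}"
| "instr_types (DirCall i j m Ts ks l) = Conc ` set Ts"
| "instr_types _ = {}"

text \<open>\<open>Entry m \<tau>' s \<tau>\<close> is the entry with name \<open>m\<close>, signature \<open>\<tau>'\<close>, body \<open>s\<close> and original
  signature \<open>\<tau>\<close>.\<close>

datatype mentry = Entry (ename: mname) (esig: "ty list") (ebody: "instr list") (eorig: "ty list")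

type_synonym mtable = "mentry fset"

definition is_original :: "mentry \<Rightarrow> bool" where
  "is_original e \<longleftrightarrow> esig e = eorig e"

definition originals :: "mtable \<Rightarrow> mtable" where
  "originals M = ffilter is_original M"

definition entry_types :: "mentry \<Rightarrow> ty set" where
  "entry_types e = set (esig e) \<union> set (eorig e) \<union> (\<Union>s\<in>set (ebody e). instr_types s)"

definition has_method :: "mtable \<Rightarrow> mname \<Rightarrow> ty list \<Rightarrow> bool" where
  "has_method M m ts \<longleftrightarrow> (\<exists>e. e |\<in>| M \<and> ename e = m \<and> esig e = ts)"

definition lookup :: "mtable \<Rightarrow> mname \<Rightarrow> ty list \<Rightarrow> mentry option" where
  "lookup M m ts =
     (if \<exists>!e. e |\<in>| M \<and> ename e = m \<and> esig e = ts
      then Some (THE e. e |\<in>| M \<and> ename e = m \<and> esig e = ts) else None)"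

text \<open>Replacement of all entries (in a well-formed table, at most one) with the same name and
  signature as the given one.\<close>

definition replace_entry :: "mentry \<Rightarrow> mtable \<Rightarrow> mtable" where
  "replace_entry e M = finsert e (ffilter (\<lambda>e'. \<not> (ename e' = ename e \<and> esig e' = esig e)) M)"

text \<open>The subsequence of \<open>xs\<close> at the indices \<open>ks\<close>, undefined if an index is out of range.\<close>

definition select :: "'a list \<Rightarrow> nat list \<Rightarrow> 'a list option" where
  "select xs ks = (if \<forall>k\<in>set ks. k < length xs then Some (map ((!) xs) ks) else None)"

definition all_concrete :: "ty list \<Rightarrow> bool" where
  "all_concrete ts \<longleftrightarrow> (\<exists>Ts. ts = map Conc Ts)"


section \<open>Dispatch\<close>

type_synonym subtype = "ty \<Rightarrow> ty \<Rightarrow> bool"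

definition is_dispatch :: "subtype \<Rightarrow> mtable \<Rightarrow> mname \<Rightarrow> cty list \<Rightarrow> ty list \<Rightarrow> bool" where
  "is_dispatch sub M m Ts ts \<longleftrightarrow>
     has_method M m ts \<and> list_all2 sub (map Conc Ts) ts \<and>
     (\<forall>ts'. has_method M m ts' \<longrightarrow> list_all2 sub (map Conc Ts) ts' \<longrightarrow> list_all2 sub ts ts')"

text \<open>The signature of the selected method; it is unique because subtyping is antisymmetric.\<close>

definition dispatch :: "subtype \<Rightarrow> mtable \<Rightarrow> mname \<Rightarrow> cty list \<Rightarrow> ty list option" where
  "dispatch sub M m Ts =
     (if \<exists>!ts. is_dispatch sub M m Ts ts then Some (THE ts. is_dispatch sub M m Ts ts) else None)"


section \<open>Well-formedness\<close>

type_synonym inference = "mtable \<Rightarrow> ty list \<Rightarrow> instr list \<Rightarrow> ty list option"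

definition wf_registers :: "mentry \<Rightarrow> bool" where
  "wf_registers e \<longleftrightarrow>
     (\<forall>r < length (ebody e).
        target (ebody e ! r) = length (esig e) + r \<and>
        (\<forall>i\<in>refs (ebody e ! r). i < target (ebody e ! r)))"

definition wf_original :: "inference \<Rightarrow> mtable \<Rightarrow> mentry \<Rightarrow> bool" where
  "wf_original I M e \<longleftrightarrow>
     ebody e \<noteq> [] \<and> (\<forall>s\<in>set (ebody e). \<not> is_dir s) \<and>
     I (originals M) (esig e) (ebody e) \<noteq> None"

definition wf_instance :: "subtype \<Rightarrow> mtable \<Rightarrow> mentry \<Rightarrow> bool" where
  "wf_instance sub M e \<longleftrightarrow>
     all_concrete (esig e) \<and> list_all2 sub (esig e) (eorig e) \<and>
     (\<exists>o'. o' |\<in>| M \<and> is_original o' \<and> ename o' = ename e \<and> esig o' = eorig e) \<and>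
     (\<forall>o'. o' |\<in>| M \<and> is_original o' \<and> ename o' = ename e \<and> list_all2 sub (esig e) (esig o') \<longrightarrow>
        list_all2 sub (eorig e) (esig o'))"

definition main_name :: mname where
  "main_name = ''main''"

definition wf_table :: "type_table \<Rightarrow> subtype \<Rightarrow> inference \<Rightarrow> mtable \<Rightarrow> bool" where
  "wf_table D sub I M \<longleftrightarrow>
     has_method M main_name [] \<and>
     (\<forall>e. e |\<in>| M \<longrightarrow> entry_types e \<subseteq> {Conc IntT, Abs AnyT} \<union> declared D) \<and>
     (\<forall>e. e |\<in>| M \<longrightarrow> wf_registers e) \<and>
     (\<forall>e. e |\<in>| M \<longrightarrow> is_original e \<longrightarrow> wf_original I M e) \<and>
     (\<forall>e e'. e |\<in>| M \<longrightarrow> e' |\<in>| M \<longrightarrow> e \<noteq> e' \<longrightarrow> ename e = ename e' \<longrightarrow> esig e \<noteq> esig e') \<and>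
     (\<forall>e. e |\<in>| M \<longrightarrow> \<not> is_original e \<longrightarrow> wf_instance sub M e)"


section \<open>Compilation\<close>

text \<open>
  The partial function \<open>jit\<close> is given by its graph (\<open>jit_functional\<close> below);
  \<open>compile_seq\<close> threads the method table through a sequence of instructions.
\<close>

inductive
  compile :: "subtype \<Rightarrow> inference \<Rightarrow> ty list \<Rightarrow> instr \<Rightarrow> mtable \<Rightarrow> instr \<Rightarrow> mtable \<Rightarrow> bool" and
  compile_seq :: "subtype \<Rightarrow> inference \<Rightarrow> ty list \<Rightarrow> instr list \<Rightarrow> mtable \<Rightarrow> instr list \<Rightarrow> mtable \<Rightarrow> bool" and
  jit :: "subtype \<Rightarrow> inference \<Rightarrow> mtable \<Rightarrow> mname \<Rightarrow> cty list \<Rightarrow> mtable \<Rightarrow> bool"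
  for sub I where
  compile_no_call:
    "\<not> is_disp s \<Longrightarrow> \<not> is_dir s \<Longrightarrow> compile sub I ts s M s M"
| compile_keep:
    "select ts ks = Some us \<Longrightarrow> \<not> all_concrete us \<Longrightarrow>
     compile sub I ts (DispCall i j m ks l) M (DispCall i j m ks l) M"
| compile_devirtualize:
    "select ts ks = Some (map Conc Ts) \<Longrightarrow> jit sub I M m Ts M' \<Longrightarrow>
     compile sub I ts (DispCall i j m ks l) M (DirCall i j m Ts ks l) M'"
| compile_seq_Nil:
    "compile_seq sub I ts [] M [] M"
| compile_seq_Cons:
    "compile sub I ts s M s' M' \<Longrightarrow> compile_seq sub I ts ss M' ss' M'' \<Longrightarrow>
     compile_seq sub I ts (s # ss) M (s' # ss') M''"
| jit_present:
    "has_method M m (map Conc Ts) \<Longrightarrow> jit sub I M m Ts M"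
| jit_compile:
    "\<not> has_method M m (map Conc Ts) \<Longrightarrow>
     dispatch sub M m Ts = Some ts \<Longrightarrow>
     lookup M m ts = Some e \<Longrightarrow>
     ebody e \<noteq> [] \<Longrightarrow>
     I (originals M) (map Conc Ts) (ebody e) = Some us \<Longrightarrow>
     compile_seq sub I (map Conc Ts @ us) (ebody e)
       (finsert (Entry m (map Conc Ts) [] ts) M) ss' M' \<Longrightarrow>
     jit sub I M m Ts (replace_entry (Entry m (map Conc Ts) ss' ts) M')"

lemma jit_functional_aux:
  "(compile sub I ts s M s1 M1 \<longrightarrow> (\<forall>s2 M2. compile sub I ts s M s2 M2 \<longrightarrow> s1 = s2 \<and> M1 = M2)) \<and>
   (compile_seq sub I us ss N ss1 N1 \<longrightarrow>
      (\<forall>ss2 N2. compile_seq sub I us ss N ss2 N2 \<longrightarrow> ss1 = ss2 \<and> N1 = N2)) \<and>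
   (jit sub I K m Ts K1 \<longrightarrow> (\<forall>K2. jit sub I K m Ts K2 \<longrightarrow> K1 = K2))"
proof (induction rule: compile_compile_seq_jit.induct)
  case (compile_no_call s ts M)
  show ?case
  proof (intro allI impI)
    fix s2 M2
    assume "compile sub I ts s M s2 M2"
    then show "s = s2 \<and> M = M2"
      by cases (use compile_no_call in simp_all)
  qed
next
  case (compile_keep ts ks us i j m l M)
  show ?case
  proof (intro allI impI)
    fix s2 M2
    assume "compile sub I ts (DispCall i j m ks l) M s2 M2"
    then show "DispCall i j m ks l = s2 \<and> M = M2"
      by cases (use compile_keep in \<open>auto simp: all_concrete_def\<close>)
  qed
next
  case (compile_devirtualize ts ks Ts M m M' i j l)
  note hyps = compile_devirtualize.hyps and IH = compile_devirtualize.IH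
  have inj: "map Conc xs = map Conc ys \<longleftrightarrow> xs = ys" for xs ys
    by (rule inj_map_eq_map) (simp add: inj_def)
  show ?case
  proof (intro allI impI)
    fix s2 M2
    assume "compile sub I ts (DispCall i j m ks l) M s2 M2"
    then show "DirCall i j m Ts ks l = s2 \<and> M' = M2"
    proof cases
      case compile_no_call
      then show ?thesis by simp
    next
      case (compile_keep us)
      then show ?thesis using hyps(1) by (auto simp: all_concrete_def)
    next
      case (compile_devirtualize Ts2)
      have Ts2: "Ts2 = Ts" using compile_devirtualize(2) hyps(1) by (simp add: inj)
      then have "M' = M2" using compile_devirtualize(3) IH by blast
      then show ?thesis using compile_devirtualize(1) Ts2 by simp
    qed
  qed
next
  case (compile_seq_Nil ts M)
  show ?case
  proof (intro allI impI)
    fix ss2 M2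
    assume "compile_seq sub I ts [] M ss2 M2"
    then show "[] = ss2 \<and> M = M2" by cases simp_all
  qed
next
  case (compile_seq_Cons ts s M s' M' ss ss' M'')
  note IH = compile_seq_Cons.IH
  show ?case
  proof (intro allI impI)
    fix ss2 M2
    assume "compile_seq sub I ts (s # ss) M ss2 M2"
    then show "s' # ss' = ss2 \<and> M'' = M2"
    proof cases
      case (compile_seq_Cons s3 M3 ss3)
      have "s' = s3 \<and> M' = M3"
        using compile_seq_Cons(2) IH by blast
      moreover from calculation have "ss' = ss3 \<and> M'' = M2"
        using compile_seq_Cons(3) IH by blast
      ultimately show ?thesis using compile_seq_Cons(1) by simp
    qed
  qed
next
  case (jit_present M m Ts)
  show ?case
  proof (intro allI impI)
    fix M2
    assume "jit sub I M m Ts M2"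
    then show "M = M2"
      by cases (use jit_present in simp_all)
  qed
next
  case (jit_compile M m Ts ts e us ss' M')
  note prems = jit_compile
  show ?case
  proof (intro allI impI)
    fix M2
    assume "jit sub I M m Ts M2"
    then show "replace_entry (Entry m (map Conc Ts) ss' ts) M' = M2"
    proof cases
      case jit_present
      then show ?thesis using \<open>\<not> has_method M m (map Conc Ts)\<close> by simp
    next
      case (jit_compile ts2 e2 us2 ss2 M3)
      have "ts2 = ts" using jit_compile(3) \<open>dispatch sub M m Ts = Some ts\<close> by simp
      moreover from this have "e2 = e" using jit_compile(4) \<open>lookup M m ts = Some e\<close> by simp
      moreover from calculation have "us2 = us" using jit_compile(6) \<open>I (originals M) (map Conc Ts) (ebody e) = Some us\<close> by simp
      ultimately have eqs: "ts2 = ts" "e2 = e" "us2 = us" by blast+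
      have "ss' = ss2 \<and> M' = M3"
        using jit_compile(7) prems unfolding eqs by blast
      then show ?thesis using jit_compile(1) eqs(1) by simp
    qed
  qed
qed

lemma jit_functional:
  assumes "jit sub I M m Ts M1" "jit sub I M m Ts M2"
  shows "M1 = M2"
  using jit_functional_aux assms by blast

section \<open>Operational semantics\<close>

datatype val = IntV int | ObjV cty "val list"

fun type_of :: "val \<Rightarrow> cty" where
  "type_of (IntV p) = IntT"
| "type_of (ObjV T vs) = T"

type_synonym env = "val list"
type_synonym stack = "(env \<times> instr list) list"
type_synonym config = "stack \<times> mtable"

text \<open>The graph of the \<open>jit\<close> parameter of the semantics.\<close>

type_synonym jit_graph = "mtable \<Rightarrow> mname \<Rightarrow> cty list \<Rightarrow> mtable \<Rightarrow> bool"

definition jit_id :: jit_graph where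
  "jit_id M m Ts M' \<longleftrightarrow> M' = M"

inductive step :: "subtype \<Rightarrow> jit_graph \<Rightarrow> config \<Rightarrow> config \<Rightarrow> bool" for sub J where
  step_const:
    "step sub J ((E, Const i p # ss) # F, M) ((E @ [IntV p], ss) # F, M)"
| step_move:
    "j < length E \<Longrightarrow>
     step sub J ((E, Move i j # ss) # F, M) ((E @ [E ! j], ss) # F, M)"
| step_alloc:
    "select E ks = Some vs \<Longrightarrow>
     step sub J ((E, Alloc i T ks # ss) # F, M) ((E @ [ObjV T vs], ss) # F, M)"
| step_field:
    "j < length E \<Longrightarrow> E ! j = ObjV T vs \<Longrightarrow> k < length vs \<Longrightarrow>
     step sub J ((E, Field i j k # ss) # F, M) ((E @ [vs ! k], ss) # F, M)"
| step_disp_skip: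
    "j < length E \<Longrightarrow> E ! j = IntV 0 \<Longrightarrow> l < length E \<Longrightarrow>
     step sub J ((E, DispCall i j m ks l # ss) # F, M) ((E @ [E ! l], ss) # F, M)"
| step_dir_skip:
    "j < length E \<Longrightarrow> E ! j = IntV 0 \<Longrightarrow> l < length E \<Longrightarrow>
     step sub J ((E, DirCall i j m Ts ks l # ss) # F, M) ((E @ [E ! l], ss) # F, M)"
| step_disp:
    "j < length E \<Longrightarrow> E ! j \<noteq> IntV 0 \<Longrightarrow> select E ks = Some vs \<Longrightarrow>
     J M m (map type_of vs) M' \<Longrightarrow>
     dispatch sub M' m (map type_of vs) = Some ts \<Longrightarrow>
     lookup M' m ts = Some e \<Longrightarrow>
     step sub J ((E, DispCall i j m ks l # ss) # F, M)
       ((vs, ebody e) # (E, DispCall i j m ks l # ss) # F, M')"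
| step_dir:
    "j < length E \<Longrightarrow> E ! j \<noteq> IntV 0 \<Longrightarrow> select E ks = Some vs \<Longrightarrow>
     lookup M m (map Conc Ts) = Some e \<Longrightarrow>
     step sub J ((E, DirCall i j m Ts ks l # ss) # F, M)
       ((vs, ebody e) # (E, DirCall i j m Ts ks l # ss) # F, M)"
| step_return:
    "E' \<noteq> [] \<Longrightarrow>
     step sub J ((E', []) # (E, s # ss) # F, M) ((E @ [last E'], ss) # F, M)"

abbreviation steps :: "subtype \<Rightarrow> jit_graph \<Rightarrow> config \<Rightarrow> config \<Rightarrow> bool" where
  "steps sub J \<equiv> (step sub J)\<^sup>*\<^sup>*"

definition initial_stack :: stack where
  "initial_stack = [([], [Const 0 1, DispCall 1 0 main_name [] 0])]"

definition stuck :: "subtype \<Rightarrow> jit_graph \<Rightarrow> config \<Rightarrow> bool" where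
  "stuck sub J c \<longleftrightarrow> fst c \<noteq> [] \<and> (\<nexists>c'. step sub J c c')"

definition erred :: "subtype \<Rightarrow> jit_graph \<Rightarrow> config \<Rightarrow> bool" where
  "erred sub J c \<longleftrightarrow> stuck sub J c \<and>
     (\<exists>E i j m ks l ss F M vs.
        c = ((E, DispCall i j m ks l # ss) # F, M) \<and>
        (\<exists>ts. has_method M m ts) \<and>
        select E ks = Some vs \<and>
        dispatch sub M m (map type_of vs) = None)"


section \<open>Standing assumptions\<close>

definition sound_inference :: "subtype \<Rightarrow> inference \<Rightarrow> jit_graph \<Rightarrow> bool" where
  "sound_inference sub I J \<longleftrightarrow>
     (\<forall>M ts ss ts' E F.
        I M ts ss = Some ts' \<longrightarrow> list_all2 sub (map (Conc \<circ> type_of) E) ts \<longrightarrow>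
        (\<forall>F' M'.
           steps sub J ((E, ss) # F, M) (F' @ F, M') \<longrightarrow>
           F' \<noteq> [] \<longrightarrow> (\<nexists>E'. F' = [(E', [])]) \<longrightarrow>
           stuck sub J (F' @ F, M') \<longrightarrow> erred sub J (F' @ F, M')) \<and>
        (\<forall>E' ss'' M'.
           steps sub J ((E, ss) # F, M) ((E @ E', ss'') # F, M') \<longrightarrow>
           (\<exists>ss'. ss = ss' @ ss'') \<and>
           (\<forall>i < length E'. sub (Conc (type_of (E' ! i))) (ts' ! i))))"

locale jit_setting =
  fixes D :: type_table and sub :: subtype and I :: inference
  assumes sub_refl: "sub t t"
    and sub_trans: "sub t t' \<Longrightarrow> sub t' t'' \<Longrightarrow> sub t t''"
    and sub_antisym: "sub t t' \<Longrightarrow> sub t' t \<Longrightarrow> t = t'"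
    and sub_Any: "sub t (Abs AnyT)"
    and sub_declared: "fmlookup D n = Some (fs, a) \<Longrightarrow> sub (Conc (CName n)) (Abs a)"
    and sub_concrete: "sub t (Conc T) \<Longrightarrow> t = Conc T"
    and infer_length: "I M ts ss = Some ts' \<Longrightarrow> length ts' = length ss"
    and infer_mono:
      "I M ts ss = Some ts' \<Longrightarrow> list_all2 sub us ts \<Longrightarrow>
       \<exists>us'. I M us ss = Some us' \<and> list_all2 sub us' ts'"
    and infer_sound: "sound_inference sub I (jit sub I)"
    and infer_sound_id: "sound_inference sub I jit_id"


section \<open>Groundedness and devirtualization\<close>

text \<open>The original method with the given name and signature is type-grounded for \<open>Ts\<close>.\<close>

definition grounded_original ::
    "subtype \<Rightarrow> inference \<Rightarrow> mtable \<Rightarrow> mname \<Rightarrow> ty list \<Rightarrow> cty list \<Rightarrow> bool" where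
  "grounded_original sub I M m ts Ts \<longleftrightarrow>
     list_all2 sub (map Conc Ts) ts \<and>
     (\<exists>o' us. lookup M m ts = Some o' \<and> is_original o' \<and>
        I (originals M) (map Conc Ts) (ebody o') = Some us \<and> all_concrete us)"

definition grounded_instance :: "subtype \<Rightarrow> inference \<Rightarrow> mtable \<Rightarrow> mentry \<Rightarrow> bool" where
  "grounded_instance sub I M e \<longleftrightarrow>
     e |\<in>| M \<and> \<not> is_original e \<and>
     (\<exists>Ts. esig e = map Conc Ts \<and> grounded_original sub I M (ename e) (eorig e) Ts)"

definition fully_devirtualized :: "mentry \<Rightarrow> bool" where
  "fully_devirtualized e \<longleftrightarrow> (\<forall>s\<in>set (ebody e). \<not> is_disp s)"

end

theory Submission
  imports Defs
begin

text \<open>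
  Compilation never touches the original methods, and every instance is either a stub or the
  result of compiling the body of its original method under the inferred register types. If all
  register types are concrete, rule \<open>compile_keep\<close> never applies, so that every dispatched call
  is turned into a direct one. The original selected when the instance was compiled is the one
  found in the final table, because originals are determined by their name and signature.
\<close>

text \<open>The originals are a separate parameter \<open>Os\<close>, not read off a current table,
  so the property of an entry survives every change to the instances around it. The disjunct for an
  empty body lets the invariant hold while a method is still being compiled.\<close>

definition compiled_instance :: "inference \<Rightarrow> mtable \<Rightarrow> mentry \<Rightarrow> bool" where
  "compiled_instance I Os e \<longleftrightarrow>
     (\<exists>Ts. esig e = map Conc Ts \<and>
        (ebody e = [] \<or>
         (\<exists>e0 us. e0 |\<in>| Os \<and> ename e0 = ename e \<and> esig e0 = eorig e \<and>
            I Os (map Conc Ts) (ebody e0) = Some us \<and>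
            (all_concrete us \<longrightarrow> fully_devirtualized e))))"

definition compiled_table :: "inference \<Rightarrow> mtable \<Rightarrow> mtable \<Rightarrow> bool" where
  "compiled_table I Os M \<longleftrightarrow>
     originals M = Os \<and> (\<forall>e. e |\<in>| M \<longrightarrow> \<not> is_original e \<longrightarrow> compiled_instance I Os e)"

lemma in_originals: "e |\<in>| originals M \<longleftrightarrow> e |\<in>| M \<and> is_original e"
  by (auto simp: originals_def)

lemma all_concrete_iff: "all_concrete ts \<longleftrightarrow> (\<forall>t\<in>set ts. \<exists>T. t = Conc T)"
  by (induction ts) (auto simp: all_concrete_def Cons_eq_map_conv)

lemma all_concrete_select:
  assumes "select ts ks = Some us" "all_concrete ts"
  shows "all_concrete us"
  using assms by (auto simp: select_def all_concrete_iff split: if_splits)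

lemma lookup_SomeD:
  assumes "lookup M m ts = Some e"
  shows "e |\<in>| M" "ename e = m" "esig e = ts"
proof -
  have ex: "\<exists>!e. e |\<in>| M \<and> ename e = m \<and> esig e = ts"
    by (rule ccontr) (use assms in \<open>unfold lookup_def, simp only: if_False option.distinct\<close>)
  moreover have "e = (THE e. e |\<in>| M \<and> ename e = m \<and> esig e = ts)"
    using assms unfolding lookup_def if_P[OF ex] by simp
  ultimately show "e |\<in>| M" "ename e = m" "esig e = ts"
    using theI'[OF ex] by simp_all
qed

lemma dispatch_SomeD:
  assumes "dispatch sub M m Ts = Some ts"
  shows "is_dispatch sub M m Ts ts"
proof -
  have ex: "\<exists>!ts. is_dispatch sub M m Ts ts"
    by (rule ccontr) (use assms in \<open>unfold dispatch_def, simp only: if_False option.distinct\<close>)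
  show ?thesis
    using theI'[OF ex] assms unfolding dispatch_def if_P[OF ex] by simp
qed

lemma compiled_table_finsert:
  assumes "compiled_table I Os M" "compiled_instance I Os e" "\<not> is_original e"
  shows "compiled_table I Os (finsert e M)"
  using assms by (auto simp: compiled_table_def originals_def)

text \<open>The last hypothesis guarantees that the filter inside \<open>replace_entry\<close>
  discards instances only.\<close>

lemma compiled_table_replace_entry:
  assumes "compiled_table I Os M" "compiled_instance I Os e" "\<not> is_original e"
    and "\<And>o'. o' |\<in>| Os \<Longrightarrow> ename o' = ename e \<Longrightarrow> esig o' \<noteq> esig e"
  shows "compiled_table I Os (replace_entry e M)"
proof -
  let ?N = "ffilter (\<lambda>e'. \<not> (ename e' = ename e \<and> esig e' = esig e)) M"
  have "originals ?N = Os"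
    using assms(1,4) by (auto simp: compiled_table_def in_originals intro!: fset_eqI)
  then have "compiled_table I Os ?N"
    using assms(1) by (auto simp: compiled_table_def)
  then show ?thesis
    unfolding replace_entry_def using assms(2,3) by (rule compiled_table_finsert)
qed

context jit_setting
begin

lemma list_all2_sub_concrete:
  "list_all2 sub ts (map Conc Us) \<Longrightarrow> ts = map Conc Us"
  by (induction Us arbitrary: ts) (auto simp: list_all2_Cons2 dest: sub_concrete)

text \<open>An instance could be dispatched to only if its signature were exactly \<open>Ts\<close>.\<close>

lemma dispatch_original:
  assumes "compiled_table I Os M" "\<not> has_method M m (map Conc Ts)"
    and "dispatch sub M m Ts = Some ts" "lookup M m ts = Some e"
  shows "e |\<in>| Os"
proof (rule ccontr)
  assume "e |\<notin>| Os"
  with assms(1) lookup_SomeD[OF assms(4)]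
  obtain Us where "ts = map Conc Us"
    by (auto simp: compiled_table_def in_originals compiled_instance_def)
  moreover have "list_all2 sub (map Conc Ts) ts" "has_method M m ts"
    using dispatch_SomeD[OF assms(3)] by (auto simp: is_dispatch_def)
  ultimately show False
    using assms(2) list_all2_sub_concrete by metis
qed

text \<open>The claims on emitted instructions are carried through the mutual induction because the
  \<open>jit\<close> case needs them to re-establish \<open>compiled_instance\<close> for the
  finished body.\<close>

lemma compiled_table_preserved:
  "(compile sub I ts s M s' M' \<longrightarrow> compiled_table I Os M \<longrightarrow>
      compiled_table I Os M' \<and> (all_concrete ts \<longrightarrow> \<not> is_disp s')) \<and>
   (compile_seq sub I us ss N ss' N' \<longrightarrow> compiled_table I Os N \<longrightarrow>
      compiled_table I Os N' \<and> (all_concrete us \<longrightarrow> (\<forall>s\<in>set ss'. \<not> is_disp s))) \<and>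
   (jit sub I K m Ts K' \<longrightarrow> compiled_table I Os K \<longrightarrow> compiled_table I Os K')"
proof (induction rule: compile_compile_seq_jit.induct)
  case (jit_compile M m Ts ts e us ss' M')
  show ?case
  proof
    assume inv: "compiled_table I Os M"
    note e = lookup_SomeD[OF \<open>lookup M m ts = Some e\<close>]
    have eO: "e |\<in>| Os"
      using inv jit_compile(1,4,2) by (rule dispatch_original)
    have Os: "Os = originals M"
      using inv by (simp add: compiled_table_def)
    \<comment> \<open>The selected method is present in \<open>M\<close> and \<open>m!Ts\<close> is
      not. Hence both the stub and its replacement are instances, whatever the body
      \<open>b\<close>.\<close>
    have "ts \<noteq> map Conc Ts"
      using e jit_compile(1) by (auto simp: has_method_def)
    then have inst: "\<not> is_original (Entry m (map Conc Ts) b ts)" for b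
      by (simp add: is_original_def)
    have "compiled_table I Os (finsert (Entry m (map Conc Ts) [] ts) M)"
      using inv inst by (intro compiled_table_finsert) (auto simp: compiled_instance_def)
    then have M': "compiled_table I Os M'"
      and ss': "all_concrete (map Conc Ts @ us) \<longrightarrow> (\<forall>s\<in>set ss'. \<not> is_disp s)"
      using jit_compile(7) by simp_all
    \<comment> \<open>The parameter types \<open>Ts\<close> are concrete anyway, so only the
      inferred types \<open>us\<close> matter.\<close>
    have "fully_devirtualized (Entry m (map Conc Ts) ss' ts)" if "all_concrete us"
      using ss' that by (auto simp: fully_devirtualized_def all_concrete_iff)
    then have "compiled_instance I Os (Entry m (map Conc Ts) ss' ts)"
      using eO e jit_compile(5) unfolding compiled_instance_def Os[symmetric] by auto
    then show "compiled_table I Os (replace_entry (Entry m (map Conc Ts) ss' ts) M')"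
    proof (rule compiled_table_replace_entry[OF M' _ inst])
      show "esig o' \<noteq> esig (Entry m (map Conc Ts) ss' ts)"
        if "o' |\<in>| Os" "ename o' = ename (Entry m (map Conc Ts) ss' ts)" for o'
        using that jit_compile(1) by (auto simp: Os in_originals has_method_def)
    qed
  qed
next
  case (compile_keep ts ks us i j m l M)
  \<comment> \<open>Arguments selected from concrete register types would be concrete, contrary to
    the premise of the rule.\<close>
  then show ?case by (blast dest: all_concrete_select)
qed simp_all

lemma compiled_table_jit:
  "jit sub I K m Ts K' \<Longrightarrow> compiled_table I Os K \<Longrightarrow> compiled_table I Os K'"
  using compiled_table_preserved by blast

text \<open>Only a dispatched call with non-zero guard can change the table, and it does so through
  \<open>jit\<close>.\<close>

lemma compiled_table_steps:
  assumes "steps sub (jit sub I) c c'" "compiled_table I Os (snd c)"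
  shows "compiled_table I Os (snd c')"
  using assms
proof (induction rule: rtranclp_induct)
  case (step c' c'')
  from step.hyps(2) step.IH[OF step.prems] show ?case
    by cases (auto dest: compiled_table_jit)
qed

end

theorem mainTheorem1:
  fixes D :: type_table and sub :: subtype and I :: inference
    and M M' :: mtable and E :: env and i j l :: nat and m :: mname
    and Ts :: "cty list" and ks :: "nat list" and ss :: "instr list"
    and F :: stack and e :: mentry
  assumes "jit_setting D sub I"
    and "wf_table D sub I M"
    and "\<forall>e'. e' |\<in>| M \<longrightarrow> is_original e'"
    and "steps sub (jit sub I) (initial_stack, M) ((E, DirCall i j m Ts ks l # ss) # F, M')"
    and "lookup M' m (map Conc Ts) = Some e"
    and "grounded_instance sub I M' e"
  shows "fully_devirtualized e"
proof -
  interpret jit_setting D sub I by fact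
  \<comment> \<open>The initial table has no instances, so the invariant holds vacuously.\<close>
  have "compiled_table I (originals M) M"
    using assms(3) by (simp add: compiled_table_def)
  with compiled_table_steps[OF assms(4)] have M': "compiled_table I (originals M) M'"
    by simp
  then have orig: "originals M' = originals M"
    by (simp add: compiled_table_def)
  from assms(6) obtain Us o' us where e: "e |\<in>| M'" "\<not> is_original e" "esig e = map Conc Us"
    and o': "lookup M' (ename e) (eorig e) = Some o'" "is_original o'"
    and us: "I (originals M) (map Conc Us) (ebody o') = Some us" "all_concrete us"
    by (auto simp: grounded_instance_def grounded_original_def orig)
  have o'_in: "o' |\<in>| originals M" "ename o' = ename e" "esig o' = eorig e"
    using lookup_SomeD[OF o'(1)] o'(2) orig in_originals by blast+
  have "compiled_instance I (originals M) e"
    using M' e by (simp add: compiled_table_def)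
  then consider "ebody e = []"
    | Vs e0 vs where "esig e = map Conc Vs" "e0 |\<in>| originals M" "ename e0 = ename e"
        "esig e0 = eorig e" "I (originals M) (map Conc Vs) (ebody e0) = Some vs"
        "all_concrete vs \<longrightarrow> fully_devirtualized e"
    by (auto simp: compiled_instance_def)
  then show ?thesis
  proof cases
    case 1
    then show ?thesis by (simp add: fully_devirtualized_def)
  next
    case 2
    \<comment> \<open>Both are entries of the well-formed initial table with the same name and
      signature. As \<open>Conc\<close> is injective, \<open>Vs\<close> equals \<open>Us\<close>,
      and so \<open>vs\<close> equals the concrete \<open>us\<close>.\<close>
    have "e0 = o'"
      using assms(2) 2 o'_in unfolding wf_table_def in_originals by metis
    then show ?thesis
      using 2 us e(3) by simp
  qed
qed

end
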